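(* The multiple-switching order scheme, with the order switched at every sample time, is equivalent to the 2nd type of fractional variable order derivative. Precisely: let $h>0$, let $k\ge 0$ be an integer, let $f$ and $\alpha$ be real functions on $[0,kh]$, put $\alpha_j=\alpha(jh)$ for $0\le j\le k$, $\bar\alpha_0=\alpha_0$ and $\bar\alpha_j=\alpha_j-\alpha_{j-1}$ for $1\le j\le k$ (so that $\alpha_j=\sum_{l=0}^{j}\bar\alpha_l$). Let $$\begin{pmatrix} y_0\\ \vdots\\ y_k\end{pmatrix}=W(\bar\alpha_0,k,0)\,W(\bar\alpha_1,k,1)\cdots W(\bar\alpha_k,k,k)\begin{pmatrix} f(0)\\ \vdots\\ f(kh)\end{pmatrix}$$ be the output with step $h$ of the multiple-switching scheme. Then for every $0\le i\le k$, $$y_i=\sum_{r=0}^{i}\frac{(-1)^r}{h^{\alpha(ih-rh)}}\binom{\alpha(ih-rh)}{r}f(ih-rh),$$ i.e. $y_i$ is exactly the expression under the limit $h\to0$ in the definition of the 2nd type derivative ${}_0\mathrm{D}^{\alpha(t)}_t f(t)$ at $t=ih$.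
   Context: For $\alpha\in\mathbb{R}$ and an integer $i\ge 0$, $\binom{\alpha}{i}=\frac{\alpha(\alpha-1)\cdots(\alpha-i+1)}{i!}$ (with $\binom{\alpha}{0}=1$), and for the step $h>0$, $w_{\alpha,i}=\frac{(-1)^i\binom{\alpha}{i}}{h^{\alpha}}$. The 2nd type of fractional variable order derivative is $${}_0\mathrm{D}^{\alpha(t)}_t f(t)=\lim_{h\to 0}\sum_{r=0}^{n}\frac{(-1)^r}{h^{\alpha(t-rh)}}\binom{\alpha(t-rh)}{r}f(t-rh),\qquad n=\lfloor t/h\rfloor .$$ For an integer $m\ge 0$, $W(\alpha,m)\in\mathbb{R}^{(m+1)\times(m+1)}$ is the lower triangular Toeplitz matrix with rows and columns indexed by $0,\dots,m$, whose $(p,q)$ entry is $w_{\alpha,p-q}$ if $p\ge q$ and $0$ if $p<q$ (the step-$h$ Grunwald-Letnikov derivative of constant order $\alpha$). For $0\le j\le k$, $$W(\alpha,k,j)=\begin{pmatrix} I_{j,j} & 0_{j,k-j+1}\\ 0_{k-j+1,j} & W(\alpha,k-j)\end{pmatrix}$$ (so $W(\alpha,k,0)=W(\alpha,k)$), where $I_{j,j}$ is the identity matrix and $0_{p,q}$ the $p\times q$ zero matrix. The matrix $W(\alpha,k,j)$ represents a derivative block of order $\alpha$ that leaves the signal unchanged before sample $j$ and starts acting at time $jh$. Multiple-switching scheme: a chain of derivative blocks. Initially only the block of order $\alpha_0$, started at time $0$, acts on the signal $f$. Whenever the order is switched from $\alpha_{j-1}$ to $\alpha_j$ at sample time $jh$,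 a derivative block of complementary order $\bar\alpha_j=\alpha_j-\alpha_{j-1}$, started at time $jh$, is pre-connected in front of (on the input side of) the existing chain. Thus at step $h$ the signal $f$ passes successively through the blocks $W(\bar\alpha_k,k,k),\dots,W(\bar\alpha_1,k,1),W(\bar\alpha_0,k,0)$. *)

theory Defs
  imports Complex_Main "Jordan_Normal_Form.Matrix"
begin

definition gl_weight :: "real \<Rightarrow> real \<Rightarrow> nat \<Rightarrow> real" where
  "gl_weight h \<alpha> i = (-1) ^ i * (\<alpha> gchoose i) / h powr \<alpha>"

definition gl_mat :: "real \<Rightarrow> real \<Rightarrow> nat \<Rightarrow> real mat" where
  "gl_mat h \<alpha> m =
     mat (m + 1) (m + 1) (\<lambda>(p, q). if q \<le> p then gl_weight h \<alpha> (p - q) else 0)"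

text \<open>The block acting from sample \<open>j\<close> on; meaningful for \<open>j \<le> k\<close> only,
  since \<open>k - j\<close> is truncated.\<close>

definition gl_block :: "real \<Rightarrow> real \<Rightarrow> nat \<Rightarrow> nat \<Rightarrow> real mat" where
  "gl_block h \<alpha> k j =
     four_block_mat (1\<^sub>m j) (0\<^sub>m j (k - j + 1))
                    (0\<^sub>m (k - j + 1) j) (gl_mat h \<alpha> (k - j))"

definition switch_order :: "real \<Rightarrow> (real \<Rightarrow> real) \<Rightarrow> nat \<Rightarrow> real" where
  "switch_order h \<alpha> j =
     (if j = 0 then \<alpha> 0 else \<alpha> (real j * h) - \<alpha> (real (j - 1) * h))"

lemma sum_switch_order: "(\<Sum>l\<le>j. switch_order h \<alpha> l) = \<alpha> (real j * h)"
  by (induction j) (simp_all add: switch_order_def)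

text \<open>The fold multiplies the blocks in the order \<open>0, 1, \<dots>, k\<close> from left to right, so
  block \<open>k\<close>, the one connected last, acts on the input signal first.\<close>

definition switching_mat :: "real \<Rightarrow> (real \<Rightarrow> real) \<Rightarrow> nat \<Rightarrow> real mat" where
  "switching_mat h \<alpha> k =
     foldr (\<lambda>j A. gl_block h (switch_order h \<alpha> j) k j * A) [0..<Suc k] (1\<^sub>m (k + 1))"

definition switching_output ::
  "real \<Rightarrow> (real \<Rightarrow> real) \<Rightarrow> (real \<Rightarrow> real) \<Rightarrow> nat \<Rightarrow> real vec" where
  "switching_output h \<alpha> f k =
     switching_mat h \<alpha> k *\<^sub>v vec (k + 1) (\<lambda>i. f (real i * h))"

definition type2_sum :: "real \<Rightarrow> (real \<Rightarrow> real) \<Rightarrow> (real \<Rightarrow> real) \<Rightarrow> real \<Rightarrow> real" where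
  "type2_sum h \<alpha> f t =
     (\<Sum>r = 0..nat \<lfloor>t / h\<rfloor>. (-1) ^ r / h powr \<alpha> (t - real r * h)
        * (\<alpha> (t - real r * h) gchoose r) * f (t - real r * h))"

text \<open>The derivative itself, included to identify \<^const>\<open>type2_sum\<close> as the expression under the limit;
  the step tends to zero through positive values.\<close>

definition type2_derivative :: "(real \<Rightarrow> real) \<Rightarrow> (real \<Rightarrow> real) \<Rightarrow> real \<Rightarrow> real" where
  "type2_derivative \<alpha> f t = Lim (at_right 0) (\<lambda>h. type2_sum h \<alpha> f t)"

end

theory Submission
  imports Defs "HOL-Computational_Algebra.Formal_Power_Series"
begin

text \<open>
  The weights of order \<open>\<alpha>\<close> are \<open>h powr (- \<alpha>)\<close> times the coefficients of \<open>(1 - X)\<close> to the power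
  \<open>\<alpha>\<close>, so Vandermonde's convolution makes orders add under convolution of weight sequences
  (\<open>gl_weight_convolution\<close>). Multiplying the chain of blocks \<open>0, \<dots>, n - 1\<close> on the right by block \<open>n\<close>
  leaves the columns \<open>q < n\<close> alone. In a column \<open>q \<ge> n\<close> it only combines columns \<open>m \<ge> q \<ge> n\<close>
  of the chain; all these have the same accumulated order, to which the order of block \<open>n\<close> is added. By
  induction (\<open>gl_chain_index\<close>), column \<open>q\<close> of the complete chain carries the sum of the orders of
  the blocks \<open>0, \<dots>, q\<close>. This sum telescopes to \<open>\<alpha> (q h)\<close>, so sample \<open>f (q h)\<close> is weighted with
  the order in force at its own time \<open>q h\<close>, which is what the second type of derivative prescribes.
\<close>

lemma gl_weight_order_0:
  assumes "h > 0"
  shows "gl_weight h 0 i = (if i = 0 then 1 else 0)"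
  using assms by (cases i) (simp_all add: gl_weight_def)

lemma gl_weight_convolution:
  "(\<Sum>i=0..n. gl_weight h \<alpha> i * gl_weight h \<beta> (n - i)) = gl_weight h (\<alpha> + \<beta>) n"
proof -
  have "(\<Sum>i=0..n. gl_weight h \<alpha> i * gl_weight h \<beta> (n - i)) =
      (\<Sum>i=0..n. (-1) ^ n / h powr (\<alpha> + \<beta>) * ((\<alpha> gchoose i) * (\<beta> gchoose (n - i))))"
  proof (rule sum.cong)
    fix i assume "i \<in> {0..n}"
    then have "(-1 :: real) ^ n = (-1) ^ i * (-1) ^ (n - i)"
      by (simp flip: power_add)
    then show "gl_weight h \<alpha> i * gl_weight h \<beta> (n - i) =
        (-1) ^ n / h powr (\<alpha> + \<beta>) * ((\<alpha> gchoose i) * (\<beta> gchoose (n - i)))"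
      by (simp add: gl_weight_def powr_add)
  qed simp
  also have "\<dots> = (-1) ^ n / h powr (\<alpha> + \<beta>) * (\<Sum>i=0..n. (\<alpha> gchoose i) * (\<beta> gchoose (n - i)))"
    by (rule sum_distrib_left[symmetric])
  also have "\<dots> = gl_weight h (\<alpha> + \<beta>) n"
    by (simp add: gl_weight_def gbinomial_Vandermonde)
  finally show ?thesis .
qed

lemma gl_block_carrier:
  assumes "j \<le> k"
  shows "gl_block h \<alpha> k j \<in> carrier_mat (k + 1) (k + 1)"
  using assms by (auto simp: gl_block_def gl_mat_def)

lemma gl_block_index:
  assumes "j \<le> k" "p \<le> k" "q \<le> k"
  shows "gl_block h \<alpha> k j $$ (p, q) =
    (if q < j then if p = q then 1 else 0
     else if q \<le> p then gl_weight h \<alpha> (p - q) else 0)"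
  using assms by (auto simp: gl_block_def gl_mat_def)

text \<open>The product of the blocks \<open>0, \<dots>, n - 1\<close> with arbitrary orders \<open>a 0, \<dots>, a (n - 1)\<close>.\<close>

definition gl_chain :: "real \<Rightarrow> (nat \<Rightarrow> real) \<Rightarrow> nat \<Rightarrow> nat \<Rightarrow> real mat" where
  "gl_chain h a k n = foldr (\<lambda>j A. gl_block h (a j) k j * A) [0..<n] (1\<^sub>m (k + 1))"

lemma foldr_mat_mult:
  fixes B :: "'b \<Rightarrow> 'a :: semiring_1 mat"
  assumes "\<And>j. j \<in> set js \<Longrightarrow> B j \<in> carrier_mat n n" and "M \<in> carrier_mat n n"
  shows "foldr (\<lambda>j A. B j * A) js (1\<^sub>m n) \<in> carrier_mat n n \<and>
    foldr (\<lambda>j A. B j * A) js M = foldr (\<lambda>j A. B j * A) js (1\<^sub>m n) * M"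
  using assms
proof (induction js)
  case (Cons j js)
  then show ?case
    using assoc_mult_mat[of "B j" n n "foldr (\<lambda>j A. B j * A) js (1\<^sub>m n)" n M n]
    by (auto intro!: mult_carrier_mat)
qed simp

lemma gl_chain_carrier:
  assumes "n \<le> k + 1"
  shows "gl_chain h a k n \<in> carrier_mat (k + 1) (k + 1)"
  unfolding gl_chain_def
  using assms foldr_mat_mult[of "[0..<n]" "\<lambda>j. gl_block h (a j) k j" "k + 1" "1\<^sub>m (k + 1)"]
  by (simp add: gl_block_carrier[simplified])

lemma gl_chain_Suc:
  assumes "n \<le> k"
  shows "gl_chain h a k (Suc n) = gl_chain h a k n * gl_block h (a n) k n"
proof -
  have "gl_chain h a k (Suc n) =
      foldr (\<lambda>j A. gl_block h (a j) k j * A) [0..<n] (gl_block h (a n) k n)"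
    using right_mult_one_mat[OF gl_block_carrier[OF assms, of h "a n"]] by (simp add: gl_chain_def)
  also have "\<dots> = gl_chain h a k n * gl_block h (a n) k n"
    unfolding gl_chain_def
    by (rule conjunct2[OF foldr_mat_mult]) (use assms gl_block_carrier in auto)
  finally show ?thesis .
qed

text \<open>Each column of the chain is a shifted weight sequence, whose order is the sum of the orders of
  those blocks that start no later than the sample of that column.\<close>

lemma gl_chain_index:
  assumes "h > 0" "n \<le> k + 1" "p \<le> k" "q \<le> k"
  shows "gl_chain h a k n $$ (p, q) =
    (if q \<le> p then gl_weight h (\<Sum>l<min n (Suc q). a l) (p - q) else 0)"
  using assms(2-4)
proof (induction n arbitrary: p q)
  case 0
  then show ?case
    using \<open>h > 0\<close> by (auto simp: gl_chain_def gl_weight_order_0)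
next
  case (Suc n)
  let ?C = "gl_chain h a k n" and ?B = "gl_block h (a n) k n"
  have n: "n \<le> k" using Suc.prems by simp
  have dims: "dim_row ?C = k + 1" "dim_col ?C = k + 1" "dim_row ?B = k + 1" "dim_col ?B = k + 1"
    using gl_chain_carrier[of n k h a] gl_block_carrier[OF n, of h "a n"] n by auto
  have product: "gl_chain h a k (Suc n) $$ (p, q) = (\<Sum>m=0..k. ?C $$ (p, m) * ?B $$ (m, q))"
    using Suc.prems
    by (simp add: gl_chain_Suc[OF n] dims scalar_prod_def atLeastLessThanSuc_atLeastAtMost)
  show ?case
  proof (cases "q < n")
    case True
    have "(\<Sum>m=0..k. ?C $$ (p, m) * ?B $$ (m, q)) = (\<Sum>m=0..k. if m = q then ?C $$ (p, m) else 0)"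
      by (rule sum.cong) (use True Suc.prems n in \<open>auto simp: gl_block_index\<close>)
    also have "\<dots> = ?C $$ (p, q)"
      using Suc.prems by simp
    finally show ?thesis
      using True Suc.prems Suc.IH[of p q] product
      by (simp add: min_absorb2 del: sum.lessThan_Suc)
  next
    case False
    let ?s = "\<Sum>l<n. a l"
    \<comment> \<open>Both factors are lower triangular, so only rows \<open>q, \<dots>, p\<close> contribute; since \<open>q \<ge> n\<close>, all the
      columns of the chain met there have the same order.\<close>
    have "(\<Sum>m=0..k. ?C $$ (p, m) * ?B $$ (m, q)) =
        (\<Sum>m=q..p. gl_weight h ?s (p - m) * gl_weight h (a n) (m - q))"
      by (rule sum.mono_neutral_cong_right)
        (use False Suc.prems n in \<open>auto simp: gl_block_index Suc.IH min_def\<close>)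
    also have "\<dots> = (if q \<le> p then gl_weight h (?s + a n) (p - q) else 0)"
    proof (cases "q \<le> p")
      case True
      have "(\<Sum>m=q..p. gl_weight h ?s (p - m) * gl_weight h (a n) (m - q)) =
          (\<Sum>i=0..p-q. gl_weight h ?s i * gl_weight h (a n) (p - q - i))"
        by (rule sum.reindex_bij_witness[of _ "\<lambda>i. p - i" "\<lambda>m. p - m"]) (use True in auto)
      then show ?thesis
        using True by (simp only: gl_weight_convolution if_True)
    qed simp
    finally show ?thesis
      using False product by (simp add: min_def)
  qed
qed

lemma switching_output_index:
  assumes "h > 0" "i \<le> k"
  shows "switching_output h \<alpha> f k $ i =
    (\<Sum>q=0..i. gl_weight h (\<alpha> (real q * h)) (i - q) * f (real q * h))"
proof -
  let ?C = "gl_chain h (switch_order h \<alpha>) k (Suc k)"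
  have dims: "dim_row ?C = k + 1" "dim_col ?C = k + 1"
    using gl_chain_carrier[of "Suc k" k h "switch_order h \<alpha>"] by auto
  have entry: "?C $$ (i, q) = (if q \<le> i then gl_weight h (\<alpha> (real q * h)) (i - q) else 0)"
    if "q \<le> k" for q
    using that assms
    by (simp add: gl_chain_index lessThan_Suc_atMost sum_switch_order del: sum.lessThan_Suc)
  have "switching_mat h \<alpha> k = ?C"
    by (simp only: switching_mat_def gl_chain_def)
  then have "switching_output h \<alpha> f k $ i = (\<Sum>q=0..k. ?C $$ (i, q) * f (real q * h))"
    using assms
    by (simp add: switching_output_def dims scalar_prod_def atLeastLessThanSuc_atLeastAtMost)
  also have "\<dots> = (\<Sum>q=0..i. gl_weight h (\<alpha> (real q * h)) (i - q) * f (real q * h))"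
    by (rule sum.mono_neutral_cong_right) (use assms entry in auto)
  finally show ?thesis .
qed

theorem theorem1:
  fixes h :: real and k :: nat and f \<alpha> :: "real \<Rightarrow> real"
  assumes "h > 0"
  shows "\<forall>i\<le>k.
    switching_output h \<alpha> f k $ i =
      (\<Sum>r = 0..i. (-1) ^ r / h powr \<alpha> (real i * h - real r * h)
         * (\<alpha> (real i * h - real r * h) gchoose r) * f (real i * h - real r * h)) \<and>
    switching_output h \<alpha> f k $ i = type2_sum h \<alpha> f (real i * h)"
proof (intro allI impI)
  fix i assume "i \<le> k"
  let ?S = "\<Sum>r = 0..i. (-1) ^ r / h powr \<alpha> (real i * h - real r * h)
    * (\<alpha> (real i * h - real r * h) gchoose r) * f (real i * h - real r * h)"
  have "(\<Sum>q=0..i. gl_weight h (\<alpha> (real q * h)) (i - q) * f (real q * h)) = ?S"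
    by (rule sum.reindex_bij_witness[of _ "\<lambda>r. i - r" "\<lambda>q. i - q"])
      (auto simp: gl_weight_def of_nat_diff algebra_simps)
  then have "switching_output h \<alpha> f k $ i = ?S"
    using switching_output_index[OF assms \<open>i \<le> k\<close>] by simp
  moreover have "type2_sum h \<alpha> f (real i * h) = ?S"
    using assms by (simp add: type2_sum_def)
  ultimately show "switching_output h \<alpha> f k $ i = ?S \<and>
      switching_output h \<alpha> f k $ i = type2_sum h \<alpha> f (real i * h)"
    by simp
qed

end
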